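(* Let $\mathbf A,\mathbf B,\mathbf C$ be hoops. (i) Let $(f,g)$ be a left-associated pair with respect to $(\mathbf A,\mathbf B,\mathbf C)$, and write $g(c)=(g_1(c),g_2(c))$ for $c\in C$. Define $\overline g\colon C\to B$ by $\overline g(c)=g_2(c)$ and $\overline f\colon |\mathbf B\ltimes_{\overline g}\mathbf C|\to A$ by $\overline f(b,c)=f(b)\wedge g_1(c)$. Then $\alpha(f,g):=(\overline f,\overline g)$ is a right-associated pair with respect to $(\mathbf A,\mathbf B,\mathbf C)$. (ii) Let $(f,g)$ be a right-associated pair with respect to $(\mathbf A,\mathbf B,\mathbf C)$. Define $\overline f\colon B\to A$ by $\overline f(b)=f(b,1)$ and $\overline g\colon C\to |\mathbf A\ltimes_{\overline f}\mathbf B|$ by $\overline g(c)=(f(g(c),c),\,g(c))$. Then $\beta(f,g):=(\overline f,\overline g)$ is a left-associated pair with respect to $(\mathbf A,\mathbf B,\mathbf C)$. (iii) The maps $\alpha$ and $\beta$ are mutually inverse bijections between the set of left-associated pairs and the set of right-associated pairs with respect to $(\mathbf A,\mathbf B,\mathbf C)$. Moreover, if $\alpha(f,g)=(\overline f,\overline g)$ (equivalently $(f,g)=\beta(\overline f,\overline g)$), then $(\mathbf A\ltimes_f\mathbf B)\ltimes_g\mathbf C\cong\mathbf A\ltimes_{\overline f}(\mathbf B\ltimes_{\overline g}\mathbf C)$.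
   Context: A hoop is an algebra $\mathbf A=(A;\cdot,\rightarrow,1)$ of type $\langle 2,2,0\rangle$ such that $(A;\cdot,1)$ is a commutative monoid and the identities $x\rightarrow x=1$, $(x\cdot y)\rightarrow z=x\rightarrow(y\rightarrow z)$ and $x\cdot(x\rightarrow y)=y\cdot(y\rightarrow x)$ hold. The order is $x\leq y$ iff $x\rightarrow y=1$; infima exist and $x\wedge y=x\cdot(x\rightarrow y)$. A map $f\colon B\to A$ between hoops is a product morphism if $f(1)=1$ and $f(x)\cdot f(y)=f(x\cdot y)=f(x)\wedge f(y)=f(x\wedge y)$ for all $x,y\in B$. For such $f$, the $f$-product $\mathbf A\ltimes_f\mathbf B$ is the hoop whose universe $|\mathbf A\ltimes_f\mathbf B|$ is $\{(a,x)\in A\times B\mid a\leq f(x)\}$, with constant $(1,1)$ and operations $(a,x)\cdot(b,y)=(a\cdot b,\,x\cdot y)$ and $(a,x)\rightarrow(b,y)=(f(x\rightarrow y)\wedge(a\rightarrow b),\,x\rightarrow y)$; its order and meet are computed componentwise. A pair $(f,g)$ is a left-associated pair of product morphisms with respect to $(\mathbf A,\mathbf B,\mathbf C)$ if $f\colon \mathbf B\to\mathbf A$ and $g\colon\mathbf C\to\mathbf A\ltimes_f\mathbf B$ are product morphisms; it is a right-associated pair with respect to $(\mathbf A,\mathbf B,\mathbf C)$ if $g\colon\mathbf C\to\mathbf B$ and $f\colon\mathbf B\ltimes_g\mathbf C\to\mathbf A$ are product morphisms. Isomorphism means hoop isomorphism. *)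

theory Defs
  imports "HOL-Algebra.Group"
begin

record 'a hoop = "'a monoid" +
  imp :: "['a, 'a] \<Rightarrow> 'a" (infixr \<open>\<leadsto>\<index>\<close> 65)

locale hoop = comm_monoid A for A (structure) +
  assumes imp_closed: "\<lbrakk>x \<in> carrier A; y \<in> carrier A\<rbrakk> \<Longrightarrow> x \<leadsto> y \<in> carrier A"
    and imp_self: "x \<in> carrier A \<Longrightarrow> x \<leadsto> x = \<one>"
    and imp_curry: "\<lbrakk>x \<in> carrier A; y \<in> carrier A; z \<in> carrier A\<rbrakk>
          \<Longrightarrow> (x \<otimes> y) \<leadsto> z = x \<leadsto> (y \<leadsto> z)"
    and divisible: "\<lbrakk>x \<in> carrier A; y \<in> carrier A\<rbrakk>
          \<Longrightarrow> x \<otimes> (x \<leadsto> y) = y \<otimes> (y \<leadsto> x)"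

definition hoop_le :: "('a, 'm) hoop_scheme \<Rightarrow> 'a \<Rightarrow> 'a \<Rightarrow> bool"
  where "hoop_le A x y \<longleftrightarrow> x \<leadsto>\<^bsub>A\<^esub> y = \<one>\<^bsub>A\<^esub>"

text \<open>In a hoop this term is the infimum with respect to \<^const>\<open>hoop_le\<close>; see
  \<open>hoop_meet_le1\<close>, \<open>hoop_meet_le2\<close> and \<open>hoop_meet_greatest\<close> below.\<close>

definition hoop_meet :: "('a, 'm) hoop_scheme \<Rightarrow> 'a \<Rightarrow> 'a \<Rightarrow> 'a"
  where "hoop_meet A x y = x \<otimes>\<^bsub>A\<^esub> (x \<leadsto>\<^bsub>A\<^esub> y)"

context hoop
begin

lemma le_antisym:
  assumes "x \<in> carrier A" "y \<in> carrier A" "hoop_le A x y" "hoop_le A y x"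
  shows "x = y"
  using assms divisible[of x y] by (simp add: hoop_le_def)

lemma imp_one_imp: assumes x: "x \<in> carrier A" shows "\<one> \<leadsto> x = x"
proof (rule le_antisym)
  let ?u = "\<one> \<leadsto> x"
  have u: "?u \<in> carrier A" using x by (simp add: imp_closed)
  show "hoop_le A x ?u" unfolding hoop_le_def
    using imp_curry[of x \<one> x] x by (simp add: imp_self)
  show "hoop_le A ?u x" unfolding hoop_le_def
    using imp_curry[of ?u \<one> x] x u by (simp add: imp_self)
qed (use x in \<open>simp_all add: imp_closed\<close>)

lemma imp_one: assumes x: "x \<in> carrier A" shows "x \<leadsto> \<one> = \<one>"
proof -
  let ?v = "x \<leadsto> \<one>"
  have v: "?v \<in> carrier A" using x by (simp add: imp_closed)
  have "x \<otimes> ?v = x"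
    using divisible[of x \<one>] x by (simp add: imp_one_imp)
  then have "?v = (?v \<otimes> x) \<leadsto> \<one>" using x v by (simp add: m_comm)
  also have "\<dots> = \<one>" using x v by (simp add: imp_curry imp_self)
  finally show ?thesis .
qed

lemma le_refl: "x \<in> carrier A \<Longrightarrow> hoop_le A x x"
  by (simp add: hoop_le_def imp_self)

lemma le_one: "x \<in> carrier A \<Longrightarrow> hoop_le A x \<one>"
  by (simp add: hoop_le_def imp_one)

lemma residuation:
  "\<lbrakk>x \<in> carrier A; y \<in> carrier A; z \<in> carrier A\<rbrakk>
    \<Longrightarrow> hoop_le A (x \<otimes> y) z \<longleftrightarrow> hoop_le A x (y \<leadsto> z)"
  by (simp add: hoop_le_def imp_curry)

lemma mult_le2: "\<lbrakk>x \<in> carrier A; y \<in> carrier A\<rbrakk> \<Longrightarrow> hoop_le A (x \<otimes> y) y"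
  by (simp add: hoop_le_def imp_curry imp_self imp_one)

lemma mult_le1: "\<lbrakk>x \<in> carrier A; y \<in> carrier A\<rbrakk> \<Longrightarrow> hoop_le A (x \<otimes> y) x"
  using mult_le2[of y x] by (simp add: m_comm)

lemma le_imp_factor:
  assumes "x \<in> carrier A" "y \<in> carrier A" "hoop_le A x y"
  shows "x = (y \<leadsto> x) \<otimes> y"
  using assms divisible[of x y] by (simp add: hoop_le_def m_comm imp_closed)

lemma le_trans:
  assumes x: "x \<in> carrier A" and y: "y \<in> carrier A" and z: "z \<in> carrier A"
    and xy: "hoop_le A x y" and yz: "hoop_le A y z"
  shows "hoop_le A x z"
proof -
  have "hoop_le A ((y \<leadsto> x) \<otimes> y) z"
    using x y z yz by (simp add: hoop_le_def imp_curry imp_closed imp_one)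
  then show ?thesis using le_imp_factor[OF x y xy] by simp
qed

lemma mult_mono1:
  assumes x: "x \<in> carrier A" and y: "y \<in> carrier A" and z: "z \<in> carrier A"
    and xy: "hoop_le A x y"
  shows "hoop_le A (x \<otimes> z) (y \<otimes> z)"
proof -
  have "hoop_le A ((y \<leadsto> x) \<otimes> (y \<otimes> z)) (y \<otimes> z)"
    using x y z by (intro mult_le2) (simp_all add: imp_closed)
  then have "hoop_le A (((y \<leadsto> x) \<otimes> y) \<otimes> z) (y \<otimes> z)"
    using x y z by (simp add: m_assoc imp_closed)
  then show ?thesis using le_imp_factor[OF x y xy] by simp
qed

lemma mult_mono:
  assumes "x \<in> carrier A" "y \<in> carrier A" "u \<in> carrier A" "v \<in> carrier A"
    and "hoop_le A x y" "hoop_le A u v"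
  shows "hoop_le A (x \<otimes> u) (y \<otimes> v)"
proof (rule le_trans)
  show "hoop_le A (x \<otimes> u) (y \<otimes> u)" using assms by (simp add: mult_mono1)
  show "hoop_le A (y \<otimes> u) (y \<otimes> v)"
    using assms mult_mono1[of u v y] by (simp add: m_comm)
qed (use assms in simp_all)

lemma hoop_meet_closed:
  "\<lbrakk>x \<in> carrier A; y \<in> carrier A\<rbrakk> \<Longrightarrow> hoop_meet A x y \<in> carrier A"
  by (simp add: hoop_meet_def imp_closed)

lemma hoop_meet_comm:
  "\<lbrakk>x \<in> carrier A; y \<in> carrier A\<rbrakk> \<Longrightarrow> hoop_meet A x y = hoop_meet A y x"
  by (simp add: hoop_meet_def divisible)

lemma hoop_meet_le1:
  "\<lbrakk>x \<in> carrier A; y \<in> carrier A\<rbrakk> \<Longrightarrow> hoop_le A (hoop_meet A x y) x"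
  by (simp add: hoop_meet_def imp_closed mult_le1)

lemma hoop_meet_le2:
  "\<lbrakk>x \<in> carrier A; y \<in> carrier A\<rbrakk> \<Longrightarrow> hoop_le A (hoop_meet A x y) y"
  using hoop_meet_le1[of y x] by (simp add: hoop_meet_comm)

lemma hoop_meet_greatest:
  assumes x: "x \<in> carrier A" and y: "y \<in> carrier A" and z: "z \<in> carrier A"
    and zx: "hoop_le A z x" and zy: "hoop_le A z y"
  shows "hoop_le A z (hoop_meet A x y)"
proof -
  have z_eq: "z = (x \<leadsto> z) \<otimes> x" by (rule le_imp_factor[OF z x zx])
  have "hoop_le A (x \<leadsto> z) (x \<leadsto> y)"
    using x y z zy z_eq residuation[of "x \<leadsto> z" x y] by (simp add: imp_closed)
  then have "hoop_le A ((x \<leadsto> z) \<otimes> x) ((x \<leadsto> y) \<otimes> x)"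
    using x y z by (simp add: mult_mono1 imp_closed)
  then show ?thesis
    using x y z z_eq by (simp add: hoop_meet_def m_comm imp_closed)
qed

lemma le_meet_iff:
  assumes "x \<in> carrier A" "y \<in> carrier A" "z \<in> carrier A"
  shows "hoop_le A z (hoop_meet A x y) \<longleftrightarrow> hoop_le A z x \<and> hoop_le A z y"
  by (meson assms hoop_meet_closed hoop_meet_greatest hoop_meet_le1 hoop_meet_le2 le_trans)

lemma eqI_below:
  assumes "x \<in> carrier A" "y \<in> carrier A"
    and "\<And>z. z \<in> carrier A \<Longrightarrow> hoop_le A z x \<longleftrightarrow> hoop_le A z y"
  shows "x = y"
  using assms by (blast intro: le_antisym le_refl)

lemma hoop_meet_assoc:
  assumes "x \<in> carrier A" "y \<in> carrier A" "z \<in> carrier A"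
  shows "hoop_meet A (hoop_meet A x y) z = hoop_meet A x (hoop_meet A y z)"
  using assms by (intro eqI_below) (auto simp: hoop_meet_closed le_meet_iff)

lemma hoop_meet_eq1:
  "\<lbrakk>x \<in> carrier A; y \<in> carrier A; hoop_le A x y\<rbrakk> \<Longrightarrow> hoop_meet A x y = x"
  by (simp add: hoop_meet_def hoop_le_def)

lemma hoop_meet_idem: "x \<in> carrier A \<Longrightarrow> hoop_meet A x x = x"
  by (simp add: hoop_meet_eq1 le_refl)

lemma imp_meet:
  assumes "x \<in> carrier A" "y \<in> carrier A" "z \<in> carrier A"
  shows "x \<leadsto> hoop_meet A y z = hoop_meet A (x \<leadsto> y) (x \<leadsto> z)"
  using assms
  by (intro eqI_below)
     (auto simp: hoop_meet_closed imp_closed le_meet_iff residuation[symmetric])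

lemma idem_mult_eq_meet:
  assumes e: "e \<in> carrier A" "e \<otimes> e = e" and x: "x \<in> carrier A"
  shows "e \<otimes> x = hoop_meet A e x"
proof (rule le_antisym)
  show "hoop_le A (e \<otimes> x) (hoop_meet A e x)"
    using e x by (simp add: le_meet_iff mult_le1 mult_le2)
  have "hoop_meet A e x = e \<otimes> hoop_meet A e x"
    using e x by (simp add: hoop_meet_def imp_closed flip: m_assoc)
  then show "hoop_le A (hoop_meet A e x) (e \<otimes> x)"
    using e x mult_mono[of e e "hoop_meet A e x" x]
    by (simp add: hoop_meet_closed hoop_meet_le2 le_refl)
qed (use e x in \<open>simp_all add: hoop_meet_closed\<close>)

end

definition hoop_iso :: "('a, 'm) hoop_scheme \<Rightarrow> ('b, 'n) hoop_scheme \<Rightarrow> ('a \<Rightarrow> 'b) set"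
  where "hoop_iso A B = {h \<in> iso A B. h \<one>\<^bsub>A\<^esub> = \<one>\<^bsub>B\<^esub> \<and>
    (\<forall>x \<in> carrier A. \<forall>y \<in> carrier A. h (x \<leadsto>\<^bsub>A\<^esub> y) = h x \<leadsto>\<^bsub>B\<^esub> h y)}"

definition hoop_isomorphic :: "('a, 'm) hoop_scheme \<Rightarrow> ('b, 'n) hoop_scheme \<Rightarrow> bool"
  where "hoop_isomorphic A B \<longleftrightarrow> hoop_iso A B \<noteq> {}"

text \<open>A map from \<^term>\<open>carrier B\<close> to \<^term>\<open>carrier A\<close> is represented by the unique HOL
  function that agrees with it on \<^term>\<open>carrier B\<close> and is \<^term>\<open>undefined\<close> elsewhere, so
  that equality of HOL functions is equality of maps.\<close>

definition product_morphism :: "('b, 'n) hoop_scheme \<Rightarrow> ('a, 'm) hoop_scheme \<Rightarrow> ('b \<Rightarrow> 'a) \<Rightarrow> bool"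
  where "product_morphism B A f \<longleftrightarrow>
    f \<in> carrier B \<rightarrow>\<^sub>E carrier A \<and>
    f \<one>\<^bsub>B\<^esub> = \<one>\<^bsub>A\<^esub> \<and>
    (\<forall>x \<in> carrier B. \<forall>y \<in> carrier B.
       f x \<otimes>\<^bsub>A\<^esub> f y = f (x \<otimes>\<^bsub>B\<^esub> y) \<and>
       f (x \<otimes>\<^bsub>B\<^esub> y) = hoop_meet A (f x) (f y) \<and>
       hoop_meet A (f x) (f y) = f (hoop_meet B x y))"

definition f_product ::
  "('a, 'm) hoop_scheme \<Rightarrow> ('b \<Rightarrow> 'a) \<Rightarrow> ('b, 'n) hoop_scheme \<Rightarrow> ('a \<times> 'b) hoop"
  where "f_product A f B =
    \<lparr>carrier = {(a, x). a \<in> carrier A \<and> x \<in> carrier B \<and> hoop_le A a (f x)},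
     mult = (\<lambda>(a, x) (b, y). (a \<otimes>\<^bsub>A\<^esub> b, x \<otimes>\<^bsub>B\<^esub> y)),
     one = (\<one>\<^bsub>A\<^esub>, \<one>\<^bsub>B\<^esub>),
     imp = (\<lambda>(a, x) (b, y).
       (hoop_meet A (f (x \<leadsto>\<^bsub>B\<^esub> y)) (a \<leadsto>\<^bsub>A\<^esub> b), x \<leadsto>\<^bsub>B\<^esub> y))\<rparr>"

lemma hoop_f_product:
  assumes A: "hoop A" and B: "hoop B" and f: "product_morphism B A f"
  shows "hoop (f_product A f B)"
proof -
  interpret A: hoop A by (rule A)
  interpret B: hoop B by (rule B)
  have f_closed: "f x \<in> carrier A" if "x \<in> carrier B" for x
    using f that by (auto simp: product_morphism_def)
  have f_one: "f \<one>\<^bsub>B\<^esub> = \<one>\<^bsub>A\<^esub>"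
    using f by (simp add: product_morphism_def)
  have f_mult: "f (x \<otimes>\<^bsub>B\<^esub> y) = f x \<otimes>\<^bsub>A\<^esub> f y"
    and f_meet_mult: "hoop_meet A (f x) (f y) = f x \<otimes>\<^bsub>A\<^esub> f y"
    and f_meet: "f (hoop_meet B x y) = hoop_meet A (f x) (f y)"
    if "x \<in> carrier B" "y \<in> carrier B" for x y
    using f that by (auto simp: product_morphism_def)
  have f_idem: "f x \<otimes>\<^bsub>A\<^esub> f x = f x" if "x \<in> carrier B" for x
    using f_meet_mult[of x x] that by (simp add: A.hoop_meet_idem f_closed)
  have f_mono: "hoop_le A (f x) (f y)"
    if "x \<in> carrier B" "y \<in> carrier B" "hoop_le B x y" for x y
    using f_meet[of x y] that A.hoop_meet_le2[of "f x" "f y"]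
    by (simp add: B.hoop_meet_eq1 f_closed)
  note cl = A.imp_closed B.imp_closed A.hoop_meet_closed f_closed

  have mult_cl: "hoop_le A (a \<otimes>\<^bsub>A\<^esub> b) (f (x \<otimes>\<^bsub>B\<^esub> y))"
    if "a \<in> carrier A" "b \<in> carrier A" "x \<in> carrier B" "y \<in> carrier B"
      "hoop_le A a (f x)" "hoop_le A b (f y)" for a b x y
    using that by (simp add: f_mult A.mult_mono cl)

  have curry: "hoop_meet A (f (x \<otimes>\<^bsub>B\<^esub> y \<leadsto>\<^bsub>B\<^esub> z)) (a \<otimes>\<^bsub>A\<^esub> b \<leadsto>\<^bsub>A\<^esub> c) =
      hoop_meet A (f (x \<leadsto>\<^bsub>B\<^esub> (y \<leadsto>\<^bsub>B\<^esub> z)))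
        (a \<leadsto>\<^bsub>A\<^esub> hoop_meet A (f (y \<leadsto>\<^bsub>B\<^esub> z)) (b \<leadsto>\<^bsub>A\<^esub> c))"
    if a: "a \<in> carrier A" and b: "b \<in> carrier A" and c: "c \<in> carrier A"
      and x: "x \<in> carrier B" and y: "y \<in> carrier B" and z: "z \<in> carrier B"
      and ax: "hoop_le A a (f x)" for a b c x y z
  proof -
    let ?w = "y \<leadsto>\<^bsub>B\<^esub> z" let ?e = "f (x \<leadsto>\<^bsub>B\<^esub> ?w)"
    have "hoop_le A (?e \<otimes>\<^bsub>A\<^esub> a) (?e \<otimes>\<^bsub>A\<^esub> f x)"
      using a x y z ax by (simp add: A.mult_mono A.le_refl cl)
    moreover have "hoop_le A (?e \<otimes>\<^bsub>A\<^esub> f x) (f ?w)"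
    proof -
      have "hoop_le B ((x \<leadsto>\<^bsub>B\<^esub> ?w) \<otimes>\<^bsub>B\<^esub> x) ?w"
        using x y z by (simp add: B.residuation B.le_refl cl)
      then have "hoop_le A (f ((x \<leadsto>\<^bsub>B\<^esub> ?w) \<otimes>\<^bsub>B\<^esub> x)) (f ?w)"
        using x y z by (simp add: f_mono cl)
      then show ?thesis using x y z by (simp add: f_mult cl)
    qed
    ultimately have "hoop_le A (?e \<otimes>\<^bsub>A\<^esub> a) (f ?w)"
      using a x y z by - (rule A.le_trans[of _ "?e \<otimes>\<^bsub>A\<^esub> f x"], simp_all add: cl)
    then have "hoop_le A ?e (a \<leadsto>\<^bsub>A\<^esub> f ?w)"
      using a x y z by (simp add: A.residuation cl)
    then have "hoop_meet A ?e (a \<leadsto>\<^bsub>A\<^esub> f ?w) = ?e"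
      using a x y z by (simp add: A.hoop_meet_eq1 cl)
    then show ?thesis
      using a b c x y z
      by (simp add: A.imp_meet A.imp_curry B.imp_curry cl flip: A.hoop_meet_assoc)
  qed

  have div: "a \<otimes>\<^bsub>A\<^esub> hoop_meet A (f (x \<leadsto>\<^bsub>B\<^esub> y)) (a \<leadsto>\<^bsub>A\<^esub> b) =
      hoop_meet A (f (hoop_meet B x y)) (hoop_meet A a b)"
    if a: "a \<in> carrier A" and b: "b \<in> carrier A"
      and x: "x \<in> carrier B" and y: "y \<in> carrier B" and ax: "hoop_le A a (f x)" for a b x y
  proof -
    let ?e = "f (x \<leadsto>\<^bsub>B\<^esub> y)"
    have e: "?e \<in> carrier A" "?e \<otimes>\<^bsub>A\<^esub> ?e = ?e" using x y by (simp_all add: cl f_idem)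
    have "a \<otimes>\<^bsub>A\<^esub> hoop_meet A ?e (a \<leadsto>\<^bsub>A\<^esub> b) = a \<otimes>\<^bsub>A\<^esub> (?e \<otimes>\<^bsub>A\<^esub> (a \<leadsto>\<^bsub>A\<^esub> b))"
      using a b e by (simp add: A.idem_mult_eq_meet cl)
    also have "\<dots> = ?e \<otimes>\<^bsub>A\<^esub> hoop_meet A a b"
      using a b e by (simp add: hoop_meet_def A.m_lcomm cl)
    also have "\<dots> = hoop_meet A ?e (hoop_meet A a b)"
      using a b e by (simp add: A.idem_mult_eq_meet cl)
    also have "\<dots> = hoop_meet A (f x \<otimes>\<^bsub>A\<^esub> ?e) (hoop_meet A a b)"
    proof -
      have "f x \<otimes>\<^bsub>A\<^esub> ?e = hoop_meet A (f x) ?e"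
        using x y by (simp add: f_meet_mult cl)
      then show ?thesis
        using a b x y ax
        by (intro A.eqI_below) (auto simp: cl A.le_meet_iff intro: A.le_trans[of _ a "f x"])
    qed
    also have "f x \<otimes>\<^bsub>A\<^esub> ?e = f (hoop_meet B x y)"
      using x y by (simp add: hoop_meet_def f_mult cl)
    finally show ?thesis .
  qed

  show ?thesis
  proof (intro hoop.intro comm_monoidI hoop_axioms.intro)
    fix p q assume "p \<in> carrier (f_product A f B)" "q \<in> carrier (f_product A f B)"
    then show "p \<otimes>\<^bsub>f_product A f B\<^esub> q \<in> carrier (f_product A f B)"
      by (auto simp: f_product_def mult_cl)
  next
    show "\<one>\<^bsub>f_product A f B\<^esub> \<in> carrier (f_product A f B)"
      by (simp add: f_product_def f_one A.le_refl)
  next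
    fix p q r
    assume "p \<in> carrier (f_product A f B)" "q \<in> carrier (f_product A f B)"
      "r \<in> carrier (f_product A f B)"
    then show "(p \<otimes>\<^bsub>f_product A f B\<^esub> q) \<otimes>\<^bsub>f_product A f B\<^esub> r =
        p \<otimes>\<^bsub>f_product A f B\<^esub> (q \<otimes>\<^bsub>f_product A f B\<^esub> r)"
      by (auto simp: f_product_def A.m_assoc B.m_assoc)
  next
    fix p assume "p \<in> carrier (f_product A f B)"
    then show "\<one>\<^bsub>f_product A f B\<^esub> \<otimes>\<^bsub>f_product A f B\<^esub> p = p"
      by (auto simp: f_product_def)
  next
    fix p q assume "p \<in> carrier (f_product A f B)" "q \<in> carrier (f_product A f B)"
    then show "p \<otimes>\<^bsub>f_product A f B\<^esub> q = q \<otimes>\<^bsub>f_product A f B\<^esub> p"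
      by (auto simp: f_product_def A.m_comm B.m_comm)
  next
    fix p q assume "p \<in> carrier (f_product A f B)" "q \<in> carrier (f_product A f B)"
    then show "p \<leadsto>\<^bsub>f_product A f B\<^esub> q \<in> carrier (f_product A f B)"
      by (auto simp: f_product_def cl A.hoop_meet_le1)
  next
    fix p assume "p \<in> carrier (f_product A f B)"
    then show "p \<leadsto>\<^bsub>f_product A f B\<^esub> p = \<one>\<^bsub>f_product A f B\<^esub>"
      by (auto simp: f_product_def A.imp_self B.imp_self f_one A.hoop_meet_idem)
  next
    fix p q r
    assume "p \<in> carrier (f_product A f B)" "q \<in> carrier (f_product A f B)"
      "r \<in> carrier (f_product A f B)"
    then show "(p \<otimes>\<^bsub>f_product A f B\<^esub> q) \<leadsto>\<^bsub>f_product A f B\<^esub> r =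
        p \<leadsto>\<^bsub>f_product A f B\<^esub> (q \<leadsto>\<^bsub>f_product A f B\<^esub> r)"
      by (auto simp: f_product_def curry) (simp add: B.imp_curry)
  next
    fix p q assume "p \<in> carrier (f_product A f B)" "q \<in> carrier (f_product A f B)"
    then obtain a x b y where pq: "p = (a, x)" "q = (b, y)"
      and a: "a \<in> carrier A" "hoop_le A a (f x)" and b: "b \<in> carrier A" "hoop_le A b (f y)"
      and x: "x \<in> carrier B" and y: "y \<in> carrier B"
      by (auto simp: f_product_def)
    show "p \<otimes>\<^bsub>f_product A f B\<^esub> (p \<leadsto>\<^bsub>f_product A f B\<^esub> q) =
        q \<otimes>\<^bsub>f_product A f B\<^esub> (q \<leadsto>\<^bsub>f_product A f B\<^esub> p)"
      using div[OF a(1) b(1) x y a(2)] div[OF b(1) a(1) y x b(2)] B.divisible[OF x y]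
        A.hoop_meet_comm[OF a(1) b(1)] B.hoop_meet_comm[OF x y]
      by (simp add: f_product_def pq)
  qed
qed

definition left_pairs ::
  "('a, 'm) hoop_scheme \<Rightarrow> ('b, 'n) hoop_scheme \<Rightarrow> ('c, 'k) hoop_scheme
    \<Rightarrow> (('b \<Rightarrow> 'a) \<times> ('c \<Rightarrow> 'a \<times> 'b)) set"
  where "left_pairs A B C =
    {(f, g). product_morphism B A f \<and> product_morphism C (f_product A f B) g}"

definition right_pairs ::
  "('a, 'm) hoop_scheme \<Rightarrow> ('b, 'n) hoop_scheme \<Rightarrow> ('c, 'k) hoop_scheme
    \<Rightarrow> (('b \<times> 'c \<Rightarrow> 'a) \<times> ('c \<Rightarrow> 'b)) set"
  where "right_pairs A B C =
    {(f, g). product_morphism C B g \<and> product_morphism (f_product B g C) A f}"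

definition assoc_alpha ::
  "('a, 'm) hoop_scheme \<Rightarrow> ('b, 'n) hoop_scheme \<Rightarrow> ('c, 'k) hoop_scheme
    \<Rightarrow> ('b \<Rightarrow> 'a) \<times> ('c \<Rightarrow> 'a \<times> 'b) \<Rightarrow> ('b \<times> 'c \<Rightarrow> 'a) \<times> ('c \<Rightarrow> 'b)"
  where "assoc_alpha A B C = (\<lambda>(f, g).
    let g' = (\<lambda>c \<in> carrier C. snd (g c));
        f' = (\<lambda>(b, c) \<in> carrier (f_product B g' C). hoop_meet A (f b) (fst (g c)))
    in (f', g'))"

definition assoc_beta ::
  "('a, 'm) hoop_scheme \<Rightarrow> ('b, 'n) hoop_scheme \<Rightarrow> ('c, 'k) hoop_scheme
    \<Rightarrow> ('b \<times> 'c \<Rightarrow> 'a) \<times> ('c \<Rightarrow> 'b) \<Rightarrow> ('b \<Rightarrow> 'a) \<times> ('c \<Rightarrow> 'a \<times> 'b)"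
  where "assoc_beta A B C = (\<lambda>(f, g).
    let f' = (\<lambda>b \<in> carrier B. f (b, \<one>\<^bsub>C\<^esub>));
        g' = (\<lambda>c \<in> carrier C. (f (g c, c), g c))
    in (f', g'))"

end

theory Submission
  imports Defs
begin

text \<open>The values of a product morphism are idempotent, and multiplication by an idempotent is the
  same as taking the meet with it. So in either direction the required identities reduce to identities
  of meets. Meets in an \<open>f\<close>-product are componentwise, and both iterated products consist, up to
  rebracketing, of the triples with \<open>a \<le> f b\<close>, \<open>a \<le> g\<^sub>1 c\<close> and \<open>b \<le> g\<^sub>2 c\<close>.
  The isomorphism is therefore rebracketing; the two maps are mutually inverse because
  \<open>f (b, c) = f (b, 1) \<and> f (g c, c)\<close> whenever \<open>b \<le> g c\<close>.\<close>

section \<open>Meets and idempotents in a hoop\<close>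

context hoop
begin

lemma hoop_meet_left_comm:
  assumes "x \<in> carrier A" "y \<in> carrier A" "z \<in> carrier A"
  shows "hoop_meet A x (hoop_meet A y z) = hoop_meet A y (hoop_meet A x z)"
  using assms by (metis hoop_meet_assoc hoop_meet_comm)

lemma hoop_meet_one_left: "x \<in> carrier A \<Longrightarrow> hoop_meet A \<one> x = x"
  by (simp add: hoop_meet_def imp_one_imp)

lemma hoop_meet_one_right: "x \<in> carrier A \<Longrightarrow> hoop_meet A x \<one> = x"
  by (simp add: hoop_meet_def imp_one)

lemma hoop_meet_eq2:
  "\<lbrakk>x \<in> carrier A; y \<in> carrier A; hoop_le A y x\<rbrakk> \<Longrightarrow> hoop_meet A x y = y"
  using hoop_meet_eq1[of y x] hoop_meet_comm[of x y] by simp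

text \<open>Meets of idempotents are products, and in a commutative monoid products of idempotents
  are idempotent. This makes the values \<open>f b \<and> fst (g c)\<close> of the map built by
  \<open>assoc_alpha\<close> idempotent.\<close>

lemma idem_meet:
  assumes "d \<in> carrier A" "e \<in> carrier A" "d \<otimes> d = d" "e \<otimes> e = e"
  shows "hoop_meet A d e \<otimes> hoop_meet A d e = hoop_meet A d e"
proof -
  have "(d \<otimes> e) \<otimes> (d \<otimes> e) = (d \<otimes> d) \<otimes> (e \<otimes> e)"
    using assms(1,2) by (simp add: m_ac)
  then show ?thesis using assms by (simp add: idem_mult_eq_meet)
qed

end

section \<open>Product morphisms; order and meet in an \<open>f\<close>-product\<close>

locale hoop_product_morphism = A: hoop A + B: hoop B
  for A :: "('a, 'm) hoop_scheme" and B :: "('b, 'n) hoop_scheme" +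
  fixes f
  assumes morphism: "product_morphism B A f"
begin

lemma closed: "x \<in> carrier B \<Longrightarrow> f x \<in> carrier A"
  using morphism by (auto simp: product_morphism_def)

lemma extensional: "f \<in> extensional (carrier B)"
  using morphism by (simp add: product_morphism_def PiE_def)

lemma map_one: "f \<one>\<^bsub>B\<^esub> = \<one>\<^bsub>A\<^esub>"
  using morphism by (simp add: product_morphism_def)

lemma map_mult:
  "\<lbrakk>x \<in> carrier B; y \<in> carrier B\<rbrakk> \<Longrightarrow> f (x \<otimes>\<^bsub>B\<^esub> y) = hoop_meet A (f x) (f y)"
  using morphism by (simp add: product_morphism_def)

lemma map_meet:
  "\<lbrakk>x \<in> carrier B; y \<in> carrier B\<rbrakk> \<Longrightarrow> f (hoop_meet B x y) = hoop_meet A (f x) (f y)"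
  using morphism by (simp add: product_morphism_def)

text \<open>On values of \<open>f\<close> multiplication agrees with the meet, and the meet of an
  element with itself is that element.\<close>

lemma idem: "x \<in> carrier B \<Longrightarrow> f x \<otimes>\<^bsub>A\<^esub> f x = f x"
  using morphism closed[of x] by (simp add: product_morphism_def A.hoop_meet_idem)

lemma map_mono:
  "\<lbrakk>x \<in> carrier B; y \<in> carrier B; hoop_le B x y\<rbrakk> \<Longrightarrow> hoop_le A (f x) (f y)"
  using map_meet[of x y] A.hoop_meet_le2[of "f x" "f y"] by (simp add: B.hoop_meet_eq1 closed)

lemma hoop_product: "hoop (f_product A f B)"
  by (rule hoop_f_product[OF A.hoop_axioms B.hoop_axioms morphism])

text \<open>Once the second component of the implication is \<open>1\<close>, the factor
  \<open>f 1 = 1\<close> drops out of the first component, leaving the plain implication of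
  \<open>A\<close>.\<close>

lemma le_iff:
  assumes "p \<in> carrier (f_product A f B)" "q \<in> carrier (f_product A f B)"
  shows "hoop_le (f_product A f B) p q \<longleftrightarrow>
    hoop_le A (fst p) (fst q) \<and> hoop_le B (snd p) (snd q)"
  using assms
  by (auto simp: f_product_def hoop_le_def map_one A.hoop_meet_one_left A.imp_closed)

text \<open>The pair of meets lies in the \<open>f\<close>-product because \<open>f\<close>
  preserves meets. By \<open>le_iff\<close> it has the same lower bounds in the product as the meet
  taken there, hence equals it.\<close>

lemma meet_eq:
  assumes p: "p \<in> carrier (f_product A f B)" and q: "q \<in> carrier (f_product A f B)"
  shows "hoop_meet (f_product A f B) p q =
    (hoop_meet A (fst p) (fst q), hoop_meet B (snd p) (snd q))" (is "_ = ?m")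
proof -
  interpret P: hoop "f_product A f B" by (rule hoop_product)
  have cl: "fst r \<in> carrier A" "snd r \<in> carrier B" "hoop_le A (fst r) (f (snd r))"
    if "r \<in> carrier (f_product A f B)" for r
    using that by (auto simp: f_product_def)
  have "hoop_le A (hoop_meet A (fst p) (fst q)) (f (hoop_meet B (snd p) (snd q)))"
    using cl[OF p] cl[OF q]
    by (simp add: map_meet A.le_meet_iff A.hoop_meet_closed closed)
       (meson A.hoop_meet_closed A.hoop_meet_le1 A.hoop_meet_le2 A.le_trans closed)
  then have m: "?m \<in> carrier (f_product A f B)"
    using cl[OF p] cl[OF q] by (simp add: f_product_def A.hoop_meet_closed B.hoop_meet_closed)
  show ?thesis
  proof (rule P.eqI_below[OF P.hoop_meet_closed[OF p q] m])
    fix r assume r: "r \<in> carrier (f_product A f B)"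
    show "hoop_le (f_product A f B) r (hoop_meet (f_product A f B) p q) \<longleftrightarrow>
        hoop_le (f_product A f B) r ?m"
      using cl[OF p] cl[OF q] cl[OF r]
      by (auto simp: P.le_meet_iff[OF p q r] le_iff[OF r p] le_iff[OF r q] le_iff[OF r m]
          A.le_meet_iff B.le_meet_iff)
  qed
qed

end

lemma hoop_product_morphismI:
  assumes "hoop A" "hoop B" "product_morphism B A f"
  shows "hoop_product_morphism A B f"
  using assms by (simp add: hoop_product_morphism_def hoop_product_morphism_axioms_def)

text \<open>For idempotent values, \<open>f x \<otimes> f y\<close> is already
  \<open>f x \<and> f y\<close>, so the chain of equations reduces to two identities about
  meets.\<close>

lemma (in hoop) product_morphismI:
  assumes "\<And>x. x \<in> carrier B \<Longrightarrow> f x \<in> carrier A"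
    and "f \<in> extensional (carrier B)"
    and "f \<one>\<^bsub>B\<^esub> = \<one>"
    and "\<And>x. x \<in> carrier B \<Longrightarrow> f x \<otimes> f x = f x"
    and "\<And>x y. \<lbrakk>x \<in> carrier B; y \<in> carrier B\<rbrakk>
      \<Longrightarrow> f (x \<otimes>\<^bsub>B\<^esub> y) = hoop_meet A (f x) (f y)"
    and "\<And>x y. \<lbrakk>x \<in> carrier B; y \<in> carrier B\<rbrakk>
      \<Longrightarrow> f (hoop_meet B x y) = hoop_meet A (f x) (f y)"
  shows "product_morphism B A f"
  using assms by (auto simp: product_morphism_def PiE_def idem_mult_eq_meet)

text \<open>This and the next three rules unfold a nested product one layer at a time.\<close>

lemma mem_f_product:
  "(a, x) \<in> carrier (f_product A f B) \<longleftrightarrow>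
    a \<in> carrier A \<and> x \<in> carrier B \<and> hoop_le A a (f x)"
  by (simp add: f_product_def)

lemma f_product_mult:
  "(a, x) \<otimes>\<^bsub>f_product A f B\<^esub> (b, y) = (a \<otimes>\<^bsub>A\<^esub> b, x \<otimes>\<^bsub>B\<^esub> y)"
  by (simp add: f_product_def)

lemma f_product_one: "\<one>\<^bsub>f_product A f B\<^esub> = (\<one>\<^bsub>A\<^esub>, \<one>\<^bsub>B\<^esub>)"
  by (simp add: f_product_def)

lemma f_product_imp:
  "(a, x) \<leadsto>\<^bsub>f_product A f B\<^esub> (b, y) =
    (hoop_meet A (f (x \<leadsto>\<^bsub>B\<^esub> y)) (a \<leadsto>\<^bsub>A\<^esub> b), x \<leadsto>\<^bsub>B\<^esub> y)"
  by (simp add: f_product_def)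

section \<open>From left-associated to right-associated pairs, and the isomorphism\<close>

locale left_pair = F: hoop_product_morphism A B f + C: hoop C
  for A :: "('a, 'm) hoop_scheme" and B :: "('b, 'n) hoop_scheme" and f
    and C :: "('c, 'k) hoop_scheme" +
  fixes g
  assumes g_morphism: "product_morphism C (f_product A f B) g"
begin

sublocale P: hoop "f_product A f B" by (rule F.hoop_product)

sublocale G: hoop_product_morphism "f_product A f B" C g
  by (rule hoop_product_morphismI) (simp_all add: P.hoop_axioms C.hoop_axioms g_morphism)

text \<open>Closure and idempotency of \<open>g c\<close> in the product, read off
  componentwise.\<close>

lemma g_components:
  assumes "c \<in> carrier C"
  shows "fst (g c) \<in> carrier A" "snd (g c) \<in> carrier B" "hoop_le A (fst (g c)) (f (snd (g c)))"
    "fst (g c) \<otimes>\<^bsub>A\<^esub> fst (g c) = fst (g c)" "snd (g c) \<otimes>\<^bsub>B\<^esub> snd (g c) = snd (g c)"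
  using G.closed[OF assms] G.idem[OF assms] by (auto simp: f_product_def)

lemma g_one: "g \<one>\<^bsub>C\<^esub> = (\<one>\<^bsub>A\<^esub>, \<one>\<^bsub>B\<^esub>)"
  by (simp add: G.map_one f_product_one)

lemma g_mult: "\<lbrakk>c \<in> carrier C; d \<in> carrier C\<rbrakk> \<Longrightarrow> g (c \<otimes>\<^bsub>C\<^esub> d) =
    (hoop_meet A (fst (g c)) (fst (g d)), hoop_meet B (snd (g c)) (snd (g d)))"
  by (simp add: G.map_mult G.closed F.meet_eq)

lemma g_meet: "\<lbrakk>c \<in> carrier C; d \<in> carrier C\<rbrakk> \<Longrightarrow> g (hoop_meet C c d) =
    (hoop_meet A (fst (g c)) (fst (g d)), hoop_meet B (snd (g c)) (snd (g d)))"
  by (simp add: G.map_meet G.closed F.meet_eq)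

text \<open>The second component of \<open>assoc_alpha A B C (f, g)\<close>; it determines the
  domain of the first component \<open>f'\<close>.\<close>

definition g' where "g' = (\<lambda>c \<in> carrier C. snd (g c))"

definition f' where
  "f' = (\<lambda>(b, c) \<in> carrier (f_product B g' C). hoop_meet A (f b) (fst (g c)))"

lemma alpha_eq: "assoc_alpha A B C (f, g) = (f', g')"
  by (simp add: assoc_alpha_def f'_def g'_def Let_def)

lemma g'_morphism: "product_morphism C B g'"
  by (rule F.B.product_morphismI)
     (simp_all add: g'_def g_components g_one g_mult g_meet C.hoop_meet_closed)

sublocale G': hoop_product_morphism B C g'
  by (rule hoop_product_morphismI) (simp_all add: F.B.hoop_axioms C.hoop_axioms g'_morphism)

lemma f'_eq:
  "(b, c) \<in> carrier (f_product B g' C) \<Longrightarrow> f' (b, c) = hoop_meet A (f b) (fst (g c))"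
  by (simp add: f'_def)

text \<open>Since \<open>f\<close> and the first component of \<open>g\<close> send products and
  meets to meets, each identity is a rearrangement of a meet of four elements, two from
  \<open>f\<close> and two from \<open>g\<close>.\<close>

lemma f'_morphism: "product_morphism (f_product B g' C) A f'"
proof -
  interpret Q: hoop "f_product B g' C" by (rule G'.hoop_product)
  note cl = F.closed g_components F.A.hoop_meet_closed F.B.hoop_meet_closed C.hoop_meet_closed
  show ?thesis
  proof (rule F.A.product_morphismI)
    fix p assume p: "p \<in> carrier (f_product B g' C)"
    then obtain b c where [simp]: "p = (b, c)" and bc: "b \<in> carrier B" "c \<in> carrier C"
      by (auto simp: f_product_def)
    show "f' p \<in> carrier A" using p bc by (simp add: f'_eq cl)
    show "f' p \<otimes>\<^bsub>A\<^esub> f' p = f' p" using p bc by (simp add: f'_eq F.A.idem_meet F.idem cl)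
  next
    show "f' \<in> extensional (carrier (f_product B g' C))" by (simp add: f'_def)
    show "f' \<one>\<^bsub>f_product B g' C\<^esub> = \<one>\<^bsub>A\<^esub>"
      using Q.one_closed by (simp add: f_product_one f'_eq F.map_one g_one F.A.hoop_meet_idem)
  next
    fix p q assume p: "p \<in> carrier (f_product B g' C)" and q: "q \<in> carrier (f_product B g' C)"
    obtain b c where p_eq [simp]: "p = (b, c)" and bc: "b \<in> carrier B" "c \<in> carrier C"
      using p by (auto simp: f_product_def)
    obtain d e where q_eq [simp]: "q = (d, e)" and de: "d \<in> carrier B" "e \<in> carrier C"
      using q by (auto simp: f_product_def)
    have f'_pq: "f' p = hoop_meet A (f b) (fst (g c))" "f' q = hoop_meet A (f d) (fst (g e))"
      using p q by (simp_all add: f'_eq)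
    show "f' (p \<otimes>\<^bsub>f_product B g' C\<^esub> q) = hoop_meet A (f' p) (f' q)"
      using Q.m_closed[OF p q] bc de unfolding f'_pq
      by (simp add: f_product_mult f'_eq F.map_mult g_mult cl F.A.hoop_meet_assoc
          F.A.hoop_meet_left_comm)
    show "f' (hoop_meet (f_product B g' C) p q) = hoop_meet A (f' p) (f' q)"
      using Q.hoop_meet_closed[OF p q] bc de unfolding f'_pq G'.meet_eq[OF p q]
      by (simp add: f'_eq F.map_meet g_meet cl F.A.hoop_meet_assoc F.A.hoop_meet_left_comm)
  qed
qed

lemma alpha_right_pair: "assoc_alpha A B C (f, g) \<in> right_pairs A B C"
  by (simp add: alpha_eq right_pairs_def g'_morphism f'_morphism)

text \<open>Setting \<open>c = 1\<close> recovers \<open>f\<close>, since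
  \<open>g 1 = (1, 1)\<close>. At \<open>b = snd (g c)\<close> the value of \<open>f'\<close> is
  \<open>fst (g c)\<close>, because \<open>g c\<close> lies in the \<open>f\<close>-product and so
  \<open>fst (g c) \<le> f (snd (g c))\<close>.\<close>

lemma beta_alpha: "assoc_beta A B C (assoc_alpha A B C (f, g)) = (f, g)"
proof -
  have "f' (b, \<one>\<^bsub>C\<^esub>) = f b" if "b \<in> carrier B" for b
  proof -
    have "(b, \<one>\<^bsub>C\<^esub>) \<in> carrier (f_product B g' C)"
      using that by (simp add: mem_f_product g'_def g_one F.B.le_one)
    then show ?thesis using that by (simp add: f'_eq g_one F.A.hoop_meet_one_right F.closed)
  qed
  \<comment> \<open>Both functions are \<open>undefined\<close> off the carrier, so agreement on it
    gives equality.\<close>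
  then have "(\<lambda>b \<in> carrier B. f' (b, \<one>\<^bsub>C\<^esub>)) = f"
    by (intro extensionalityI[OF _ F.extensional]) simp_all
  moreover have "(f' (g' c, c), g' c) = g c" if "c \<in> carrier C" for c
  proof -
    have "(g' c, c) \<in> carrier (f_product B g' C)"
      using that by (simp add: mem_f_product G'.closed F.B.le_refl)
    then show ?thesis
      using that by (simp add: f'_eq g'_def F.A.hoop_meet_eq2 F.closed g_components)
  qed
  then have "(\<lambda>c \<in> carrier C. (f' (g' c, c), g' c)) = g"
    by (intro extensionalityI[OF _ G.extensional]) simp_all
  ultimately show ?thesis by (simp add: alpha_eq assoc_beta_def)
qed

lemma carrier_assoc:
  "((a, b), c) \<in> carrier (f_product (f_product A f B) g C) \<longleftrightarrow>
    (a, (b, c)) \<in> carrier (f_product A f' (f_product B g' C))"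
\<comment> \<open>If some component is outside its hoop, both memberships fail.\<close>
proof (cases "a \<in> carrier A \<and> b \<in> carrier B \<and> c \<in> carrier C")
  case True
  then have abc: "a \<in> carrier A" "b \<in> carrier B" "c \<in> carrier C" by auto
  have "((a, b), c) \<in> carrier (f_product (f_product A f B) g C) \<longleftrightarrow>
      hoop_le A a (f b) \<and> hoop_le A a (fst (g c)) \<and> hoop_le B b (snd (g c))"
    using abc F.le_iff[of "(a, b)" "g c"] G.closed[of c] by (auto simp: mem_f_product)
  moreover have "(b, c) \<in> carrier (f_product B g' C) \<longleftrightarrow> hoop_le B b (snd (g c))"
    using abc by (simp add: mem_f_product g'_def)
  \<comment> \<open>Only the outer layer is unfolded: membership of \<open>(b, c)\<close> is kept as
    the premise under which \<open>f'_eq\<close> applies.\<close>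
  moreover have "(a, (b, c)) \<in> carrier (f_product A f' (f_product B g' C)) \<longleftrightarrow>
      (b, c) \<in> carrier (f_product B g' C) \<and> hoop_le A a (f' (b, c))"
    using abc by (auto simp: mem_f_product[of a])
  ultimately show ?thesis
    using abc by (auto simp: f'_eq F.A.le_meet_iff F.closed g_components)
qed (auto simp: mem_f_product)

text \<open>With \<open>z = c \<leadsto> c'\<close>, both sides have first component \<open>fst (g
  z) \<and> f (b \<leadsto> b') \<and> (a \<leadsto> a')\<close>. On the right an extra
  \<open>f (snd (g z))\<close> arises from \<open>f'\<close>, but it is absorbed by
  \<open>fst (g z)\<close>.\<close>

lemma imp_assoc:
  assumes carr: "a \<in> carrier A" "b \<in> carrier B" "c \<in> carrier C"
      "a' \<in> carrier A" "b' \<in> carrier B" "c' \<in> carrier C"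
    and p: "(a, b) \<in> carrier (f_product A f B)" and q: "(a', b') \<in> carrier (f_product A f B)"
    and r: "(b, c) \<in> carrier (f_product B g' C)" and s: "(b', c') \<in> carrier (f_product B g' C)"
    and eq: "((a, b), c) \<leadsto>\<^bsub>f_product (f_product A f B) g C\<^esub> ((a', b'), c') = ((u, v), w)"
  shows "(a, (b, c)) \<leadsto>\<^bsub>f_product A f' (f_product B g' C)\<^esub> (a', (b', c')) = (u, (v, w))"
proof -
  interpret Q: hoop "f_product B g' C" by (rule G'.hoop_product)
  let ?z = "c \<leadsto>\<^bsub>C\<^esub> c'" and ?y = "b \<leadsto>\<^bsub>B\<^esub> b'" and ?x = "a \<leadsto>\<^bsub>A\<^esub> a'"
  let ?g1 = "fst (g ?z)" and ?g2 = "snd (g ?z)"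
  have carr': "?z \<in> carrier C" "?y \<in> carrier B" "?x \<in> carrier A"
    using carr by (simp_all add: F.A.imp_closed F.B.imp_closed C.imp_closed)
  note cl = F.closed g_components[OF carr'(1)] carr' F.A.hoop_meet_closed F.B.hoop_meet_closed
  have imp_AB: "(a, b) \<leadsto>\<^bsub>f_product A f B\<^esub> (a', b') = (hoop_meet A (f ?y) ?x, ?y)"
    by (rule f_product_imp)
  have imp_BC: "(b, c) \<leadsto>\<^bsub>f_product B g' C\<^esub> (b', c') = (hoop_meet B ?g2 ?y, ?z)"
    using carr' by (simp add: f_product_imp g'_def)
  have "((u, v), w) = (hoop_meet (f_product A f B) (g ?z) (hoop_meet A (f ?y) ?x, ?y), ?z)"
    unfolding eq[symmetric] by (simp add: f_product_imp[where a = "(a, b)"] imp_AB)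
  \<comment> \<open>The outer implication takes its meet inside the inner product, where meets are
    componentwise.\<close>
  also have "hoop_meet (f_product A f B) (g ?z) (hoop_meet A (f ?y) ?x, ?y) =
      (hoop_meet A ?g1 (hoop_meet A (f ?y) ?x), hoop_meet B ?g2 ?y)"
    using F.meet_eq[OF G.closed[OF carr'(1)] P.imp_closed[OF p q]] by (simp add: imp_AB)
  finally have uvw: "u = hoop_meet A ?g1 (hoop_meet A (f ?y) ?x)" "v = hoop_meet B ?g2 ?y" "w = ?z"
    by auto
  have "f' (hoop_meet B ?g2 ?y, ?z) = hoop_meet A (f (hoop_meet B ?g2 ?y)) ?g1"
    using Q.imp_closed[OF r s] by (simp add: imp_BC f'_eq)
  also have "\<dots> = hoop_meet A (f ?y) (hoop_meet A (f ?g2) ?g1)"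
    by (simp add: F.map_meet cl F.A.hoop_meet_assoc F.A.hoop_meet_left_comm)
  \<comment> \<open>Absorption: \<open>g ?z\<close> is an element of the \<open>f\<close>-product,
    so \<open>?g1 \<le> f ?g2\<close>.\<close>
  also have "hoop_meet A (f ?g2) ?g1 = ?g1"
    by (simp add: F.A.hoop_meet_eq2 cl)
  finally have "f' (hoop_meet B ?g2 ?y, ?z) = hoop_meet A (f ?y) ?g1" .
  then show ?thesis
    by (simp add: f_product_imp[where a = a] imp_BC uvw F.A.hoop_meet_assoc F.A.hoop_meet_left_comm cl)
qed

lemma product_assoc:
  "hoop_isomorphic (f_product (f_product A f B) g C) (f_product A f' (f_product B g' C))"
proof -
  let ?L = "f_product (f_product A f B) g C" and ?R = "f_product A f' (f_product B g' C)"
  let ?h = "\<lambda>((a, b), c). (a, (b, c))"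
  have "bij_betw ?h (carrier ?L) (carrier ?R)"
    by (rule bij_betw_byWitness[where f' = "\<lambda>(a, (b, c)). ((a, b), c)"])
       (auto simp: carrier_assoc)
  \<comment> \<open>Both multiplications are componentwise in all three coordinates; the morphisms
    enter only through implication.\<close>
  moreover have "?h (p \<otimes>\<^bsub>?L\<^esub> q) = ?h p \<otimes>\<^bsub>?R\<^esub> ?h q" for p q
    by (simp add: f_product_def split_beta)
  moreover have "?h (p \<leadsto>\<^bsub>?L\<^esub> q) = ?h p \<leadsto>\<^bsub>?R\<^esub> ?h q"
    if p: "p \<in> carrier ?L" and q: "q \<in> carrier ?L" for p q
  proof -
    obtain a b c where p_eq: "p = ((a, b), c)" by (metis surj_pair)
    obtain a' b' c' where q_eq: "q = ((a', b'), c')" by (metis surj_pair)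
    obtain u v w where r_eq: "p \<leadsto>\<^bsub>?L\<^esub> q = ((u, v), w)" by (metis surj_pair)
    show ?thesis
      using imp_assoc[of a b c a' b' c' u v w] p q r_eq
        carrier_assoc[of a b c] carrier_assoc[of a' b' c']
      unfolding p_eq q_eq r_eq by (simp add: mem_f_product)
  qed
  ultimately have "?h \<in> hoop_iso ?L ?R"
    by (auto simp: hoop_iso_def iso_def hom_def f_product_one dest: bij_betwE)
  then show ?thesis by (auto simp: hoop_isomorphic_def)
qed

end

lemma left_pair_iff:
  assumes "hoop A" "hoop B" "hoop C"
  shows "(f, g) \<in> left_pairs A B C \<longleftrightarrow> left_pair A B f C g"
  using assms by (auto simp: left_pairs_def left_pair_def left_pair_axioms_def
      hoop_product_morphism_def hoop_product_morphism_axioms_def)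

section \<open>From right-associated to left-associated pairs\<close>

locale right_pair = A: hoop A + G: hoop_product_morphism B C g
  for A :: "('a, 'm) hoop_scheme" and B :: "('b, 'n) hoop_scheme"
    and C :: "('c, 'k) hoop_scheme" and g +
  fixes f
  assumes f_morphism: "product_morphism (f_product B g C) A f"
begin

sublocale Q: hoop "f_product B g C" by (rule G.hoop_product)

sublocale F: hoop_product_morphism A "f_product B g C" f
  by (rule hoop_product_morphismI) (simp_all add: A.hoop_axioms Q.hoop_axioms f_morphism)

definition f' where "f' = (\<lambda>b \<in> carrier B. f (b, \<one>\<^bsub>C\<^esub>))"

definition g' where "g' = (\<lambda>c \<in> carrier C. (f (g c, c), g c))"

lemma beta_eq: "assoc_beta A B C (f, g) = (f', g')"
  by (simp add: assoc_beta_def f'_def g'_def)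

text \<open>The elements \<open>(b, 1)\<close> and \<open>(g c, c)\<close> generate the product
  under meets: \<open>(b, c) = (b, 1) \<and> (g c, c)\<close> whenever \<open>b \<le> g c\<close>.
  Thus \<open>f\<close> is determined by its values on them.\<close>

lemma embed_B: "b \<in> carrier B \<Longrightarrow> (b, \<one>\<^bsub>C\<^esub>) \<in> carrier (f_product B g C)"
  by (simp add: mem_f_product G.map_one G.A.le_one)

lemma embed_C: "c \<in> carrier C \<Longrightarrow> (g c, c) \<in> carrier (f_product B g C)"
  by (simp add: mem_f_product G.closed G.A.le_refl)

text \<open>\<open>f'\<close> is \<open>f\<close> after the embedding of \<open>b\<close> as
  \<open>(b, 1)\<close>, which preserves products and meets.\<close>

lemma f'_morphism: "product_morphism B A f'"
proof (rule A.product_morphismI)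
  show "f' \<one>\<^bsub>B\<^esub> = \<one>\<^bsub>A\<^esub>"
    using F.map_one by (simp add: f'_def f_product_one)
next
  fix x y assume xy: "x \<in> carrier B" "y \<in> carrier B"
  show "f' (x \<otimes>\<^bsub>B\<^esub> y) = hoop_meet A (f' x) (f' y)"
    using xy F.map_mult[OF embed_B embed_B, of x y] by (simp add: f'_def f_product_mult)
  show "f' (hoop_meet B x y) = hoop_meet A (f' x) (f' y)"
    using xy F.map_meet[OF embed_B embed_B, of x y]
    by (simp add: f'_def G.meet_eq embed_B G.A.hoop_meet_closed G.B.hoop_meet_idem)
qed (simp_all add: f'_def F.closed F.idem embed_B)

sublocale F': hoop_product_morphism A B f'
  by (rule hoop_product_morphismI) (simp_all add: A.hoop_axioms G.A.hoop_axioms f'_morphism)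

sublocale P: hoop "f_product A f' B" by (rule F'.hoop_product)

lemma g'_closed:
  assumes "c \<in> carrier C" shows "g' c \<in> carrier (f_product A f' B)"
proof -
  \<comment> \<open>Monotonicity of \<open>f\<close> turns this into
    \<open>f (g c, c) \<le> f' (g c)\<close>, the condition for membership in the
    \<open>f'\<close>-product.\<close>
  have "hoop_le (f_product B g C) (g c, c) (g c, \<one>\<^bsub>C\<^esub>)"
    using assms by (simp add: G.le_iff embed_B embed_C G.closed G.A.le_refl G.B.le_one)
  then show ?thesis
    using assms by (simp add: g'_def f'_def mem_f_product F.closed F.map_mono embed_B embed_C G.closed
        G.A.le_refl G.map_one G.A.le_one)
qed

lemma g'_morphism: "product_morphism C (f_product A f' B) g'"
proof (rule P.product_morphismI)
  show "g' \<in> extensional (carrier C)" by (simp add: g'_def)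
  show "g' \<one>\<^bsub>C\<^esub> = \<one>\<^bsub>f_product A f' B\<^esub>"
    using F.map_one by (simp add: g'_def f_product_one G.map_one)
next
  fix x assume "x \<in> carrier C"
  then show "g' x \<otimes>\<^bsub>f_product A f' B\<^esub> g' x = g' x"
    by (simp add: g'_def f_product_mult F.idem embed_C G.idem)
next
  fix x y assume xy: "x \<in> carrier C" "y \<in> carrier C"
  have g'_pair: "hoop_meet (f_product A f' B) (g' x) (g' y) =
      (hoop_meet A (f (g x, x)) (f (g y, y)), hoop_meet B (g x) (g y))"
    using xy F'.meet_eq[OF g'_closed g'_closed, of x y] by (simp add: g'_def)
  \<comment> \<open>Multiplying \<open>(g x, x)\<close> by \<open>(g y, y)\<close> produces a
    product in \<open>B\<close>, whereas \<open>G.map_mult\<close> produces a meet; idempotency of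
    the values of \<open>g\<close> identifies them.\<close>
  have "g x \<otimes>\<^bsub>B\<^esub> g y = hoop_meet B (g x) (g y)"
    using xy by (simp add: G.A.idem_mult_eq_meet G.closed G.idem)
  then show "g' (x \<otimes>\<^bsub>C\<^esub> y) = hoop_meet (f_product A f' B) (g' x) (g' y)"
    using xy F.map_mult[OF embed_C embed_C, of x y] unfolding g'_pair
    by (simp add: g'_def f_product_mult G.map_mult)
  show "g' (hoop_meet C x y) = hoop_meet (f_product A f' B) (g' x) (g' y)"
    using xy F.map_meet[OF embed_C embed_C, of x y] unfolding g'_pair
    by (simp add: g'_def G.meet_eq embed_C G.map_meet G.B.hoop_meet_closed)
qed (rule g'_closed)

lemma beta_left_pair: "assoc_beta A B C (f, g) \<in> left_pairs A B C"
  by (simp add: beta_eq left_pairs_def g'_morphism f'_morphism)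

lemma alpha_beta: "assoc_alpha A B C (assoc_beta A B C (f, g)) = (f, g)"
proof -
  \<comment> \<open>Recovering \<open>g\<close> first fixes the domain on which the other component
    is to be compared with \<open>f\<close>.\<close>
  have g: "(\<lambda>c \<in> carrier C. snd (g' c)) = g"
    by (rule extensionalityI[OF _ G.extensional]) (simp_all add: g'_def)
  have "hoop_meet A (f' b) (fst (g' c)) = f (b, c)"
    if bc: "(b, c) \<in> carrier (f_product B g C)" for b c
  proof -
    have b: "b \<in> carrier B" and c: "c \<in> carrier C" and le: "hoop_le B b (g c)"
      using bc by (simp_all add: mem_f_product)
    have "hoop_meet A (f' b) (fst (g' c)) = f (hoop_meet (f_product B g C) (b, \<one>\<^bsub>C\<^esub>) (g c, c))"
      using b c by (simp add: f'_def g'_def F.map_meet embed_B embed_C)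
    \<comment> \<open>Componentwise, \<open>b \<and> g c = b\<close> by \<open>b \<le> g c\<close>,
      and \<open>1 \<and> c = c\<close>.\<close>
    also have "hoop_meet (f_product B g C) (b, \<one>\<^bsub>C\<^esub>) (g c, c) = (b, c)"
      using b c le
      by (simp add: G.meet_eq embed_B embed_C G.A.hoop_meet_eq1 G.closed G.B.hoop_meet_one_left)
    finally show ?thesis .
  qed
  then have "(\<lambda>(b, c) \<in> carrier (f_product B g C). hoop_meet A (f' b) (fst (g' c))) = f"
    by (intro extensionalityI[OF _ F.extensional]) auto
  then show ?thesis by (simp add: beta_eq assoc_alpha_def g)
qed

end

lemma right_pair_iff:
  assumes "hoop A" "hoop B" "hoop C"
  shows "(f, g) \<in> right_pairs A B C \<longleftrightarrow> right_pair A B C g f"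
  using assms by (auto simp: right_pairs_def right_pair_def right_pair_axioms_def
      hoop_product_morphism_def hoop_product_morphism_axioms_def)

section \<open>The bijective correspondence and associativity of the products\<close>

theorem theorem12:
  fixes A :: "'a hoop" and B :: "'b hoop" and C :: "'c hoop"
  assumes "hoop A" and "hoop B" and "hoop C"
  shows "(\<forall>p \<in> left_pairs A B C. assoc_alpha A B C p \<in> right_pairs A B C) \<and>
    (\<forall>q \<in> right_pairs A B C. assoc_beta A B C q \<in> left_pairs A B C) \<and>
    bij_betw (assoc_alpha A B C) (left_pairs A B C) (right_pairs A B C) \<and>
    bij_betw (assoc_beta A B C) (right_pairs A B C) (left_pairs A B C) \<and>
    (\<forall>p \<in> left_pairs A B C. assoc_beta A B C (assoc_alpha A B C p) = p) \<and>
    (\<forall>q \<in> right_pairs A B C. assoc_alpha A B C (assoc_beta A B C q) = q) \<and>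
    (\<forall>(f, g) \<in> left_pairs A B C. \<forall>(f', g') \<in> right_pairs A B C.
       (assoc_alpha A B C (f, g) = (f', g') \<longleftrightarrow> (f, g) = assoc_beta A B C (f', g')) \<and>
       (assoc_alpha A B C (f, g) = (f', g') \<longrightarrow>
         hoop_isomorphic (f_product (f_product A f B) g C) (f_product A f' (f_product B g' C))))"
proof -
  let ?L = "left_pairs A B C" and ?R = "right_pairs A B C"
  let ?\<alpha> = "assoc_alpha A B C" and ?\<beta> = "assoc_beta A B C"
  have alpha: "?\<alpha> p \<in> ?R" "?\<beta> (?\<alpha> p) = p" if "p \<in> ?L" for p
  proof -
    obtain f g where p: "p = (f, g)" by (cases p)
    interpret left_pair A B f C g using that by (simp add: p left_pair_iff[OF assms])
    show "?\<alpha> p \<in> ?R" "?\<beta> (?\<alpha> p) = p"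
      unfolding p by (rule alpha_right_pair, rule beta_alpha)
  qed
  have beta: "?\<beta> q \<in> ?L" "?\<alpha> (?\<beta> q) = q" if "q \<in> ?R" for q
  proof -
    obtain f g where q: "q = (f, g)" by (cases q)
    interpret right_pair A B C g f using that by (simp add: q right_pair_iff[OF assms])
    show "?\<beta> q \<in> ?L" "?\<alpha> (?\<beta> q) = q"
      unfolding q by (rule beta_left_pair, rule alpha_beta)
  qed
  have "bij_betw ?\<alpha> ?L ?R"
    by (rule bij_betw_byWitness[where f' = ?\<beta>]) (auto simp: alpha beta)
  moreover have "bij_betw ?\<beta> ?R ?L"
    by (rule bij_betw_byWitness[where f' = ?\<alpha>]) (auto simp: alpha beta)
  moreover have "?\<alpha> p = q \<longleftrightarrow> p = ?\<beta> q" if "p \<in> ?L" "q \<in> ?R" for p q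
    using that alpha(2) beta(2) by metis
  moreover have "hoop_isomorphic (f_product (f_product A f B) g C)
      (f_product A f' (f_product B g' C))"
    if "(f, g) \<in> ?L" "?\<alpha> (f, g) = (f', g')" for f g f' g'
  proof -
    interpret left_pair A B f C g using that(1) by (simp add: left_pair_iff[OF assms])
    \<comment> \<open>\<open>product_assoc\<close> speaks of the maps constructed from
      \<open>(f, g)\<close>; \<open>alpha_eq\<close> identifies them with the given
      \<open>f'\<close> and \<open>g'\<close>.\<close>
    show ?thesis using product_assoc that(2) alpha_eq by simp
  qed
  ultimately show ?thesis by (intro conjI ballI) (auto simp: alpha beta)
qed

end
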